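(* Let $X$ be a finite set with at least three elements and let $\mathcal{P}=\{X_i \mid i\in I_m\}$ be a partition of $X$ into exactly $m$ blocks. Then $\Gamma(X,\mathcal{P})\cap\Sigma(X,\mathcal{P})=S(X,\mathcal{P})$.
   Context: Maps are written on the right and composed from left to right; $Af$ is the image of a subset $A$ under $f$. $I_m=\{1,\dots,m\}$. A partition of $X$ is a collection of nonempty pairwise disjoint subsets (blocks) with union $X$; distinct indices correspond to distinct blocks. $\mathcal{T}_X$ is the semigroup of all maps $X\to X$ under composition. Define the semigroups $T(X,\mathcal{P})=\{f\in\mathcal{T}_X \mid (\forall X_i\in\mathcal{P})(\exists X_j\in\mathcal{P})\; X_if\subseteq X_j\}$, $\Sigma(X,\mathcal{P})=\{f\in T(X,\mathcal{P}) \mid (\forall X_i\in\mathcal{P})\; Xf\cap X_i\neq\emptyset\}$ and $\Gamma(X,\mathcal{P})=\{f\in\mathcal{T}_X \mid (\forall X_i\in\mathcal{P})(\exists X_j\in\mathcal{P})\; X_if=X_j\}$. $S(X,\mathcal{P})$ denotes the group of units of the semigroup (with identity) $T(X,\mathcal{P})$. *)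

theory Defs
  imports "HOL-Algebra.Group" "HOL-Library.FuncSet" "HOL-Library.Disjoint_Sets"
begin

text \<open>
  Maps from X to X are the extensional functions on X, so that equality of maps is equality on X.
  Maps act on the right in the source, hence the product f g means "first f, then g".
\<close>

definition full_transf :: "'a set \<Rightarrow> ('a \<Rightarrow> 'a) monoid" where
  "full_transf X =
     \<lparr>carrier = X \<rightarrow>\<^sub>E X, mult = (\<lambda>f g. compose X g f), one = (\<lambda>x\<in>X. x)\<rparr>"

definition T_part :: "'a set \<Rightarrow> 'a set set \<Rightarrow> ('a \<Rightarrow> 'a) set" where
  "T_part X P = {f \<in> carrier (full_transf X). \<forall>A\<in>P. \<exists>B\<in>P. f ` A \<subseteq> B}"

definition Sigma_part :: "'a set \<Rightarrow> 'a set set \<Rightarrow> ('a \<Rightarrow> 'a) set" where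
  "Sigma_part X P = {f \<in> T_part X P. \<forall>A\<in>P. f ` X \<inter> A \<noteq> {}}"

definition Gamma_part :: "'a set \<Rightarrow> 'a set set \<Rightarrow> ('a \<Rightarrow> 'a) set" where
  "Gamma_part X P = {f \<in> carrier (full_transf X). \<forall>A\<in>P. \<exists>B\<in>P. f ` A = B}"

definition T_monoid :: "'a set \<Rightarrow> 'a set set \<Rightarrow> ('a \<Rightarrow> 'a) monoid" where
  "T_monoid X P = (full_transf X)\<lparr>carrier := T_part X P\<rparr>"

text \<open>The inverse of a unit is required to lie in T(X,P), not merely in the full transformation monoid.\<close>

definition S_part :: "'a set \<Rightarrow> 'a set set \<Rightarrow> ('a \<Rightarrow> 'a) set" where
  "S_part X P = Units (T_monoid X P)"

lemma monoid_full_transf: "monoid (full_transf X)"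
  by (rule monoidI)
    (auto simp: full_transf_def compose_def PiE_def extensional_def Pi_def fun_eq_iff)

lemma monoid_T_monoid:
  assumes P: "partition_on X P"
  shows "monoid (T_monoid X P)"
proof (rule monoidI)
  interpret monoid "full_transf X" by (rule monoid_full_transf)
  have img: "compose X g f ` A = g ` f ` A" if "A \<in> P" for f g A
    using that P by (force simp: compose_def partition_on_def)
  have one_img: "(\<lambda>x\<in>X. x) ` A = A" if "A \<in> P" for A
    using that P by (force simp: partition_on_def)
  show "\<one>\<^bsub>T_monoid X P\<^esub> \<in> carrier (T_monoid X P)"
    using one_img one_closed by (auto simp: T_monoid_def T_part_def full_transf_def)
  fix f g
  assume f: "f \<in> carrier (T_monoid X P)" and g: "g \<in> carrier (T_monoid X P)"
  have "\<exists>C\<in>P. compose X g f ` A \<subseteq> C" if A: "A \<in> P" for A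
  proof -
    obtain B where "B \<in> P" "f ` A \<subseteq> B" using f A by (auto simp: T_monoid_def T_part_def)
    moreover obtain C where "C \<in> P" "g ` B \<subseteq> C"
      using g \<open>B \<in> P\<close> by (auto simp: T_monoid_def T_part_def)
    ultimately show ?thesis unfolding img[OF A] by blast
  qed
  moreover have "f \<otimes>\<^bsub>full_transf X\<^esub> g \<in> carrier (full_transf X)"
    using f g by (intro m_closed) (auto simp: T_monoid_def T_part_def)
  ultimately show "f \<otimes>\<^bsub>T_monoid X P\<^esub> g \<in> carrier (T_monoid X P)"
    by (simp add: T_monoid_def T_part_def full_transf_def)
next
  interpret monoid "full_transf X" by (rule monoid_full_transf)
  fix f g h
  assume "f \<in> carrier (T_monoid X P)" "g \<in> carrier (T_monoid X P)" "h \<in> carrier (T_monoid X P)"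
  then show "f \<otimes>\<^bsub>T_monoid X P\<^esub> g \<otimes>\<^bsub>T_monoid X P\<^esub> h = f \<otimes>\<^bsub>T_monoid X P\<^esub> (g \<otimes>\<^bsub>T_monoid X P\<^esub> h)"
    using m_assoc[of f g h] by (simp add: T_monoid_def T_part_def)
next
  interpret monoid "full_transf X" by (rule monoid_full_transf)
  fix f assume "f \<in> carrier (T_monoid X P)"
  then have "f \<in> carrier (full_transf X)" by (simp add: T_monoid_def T_part_def)
  then show "\<one>\<^bsub>T_monoid X P\<^esub> \<otimes>\<^bsub>T_monoid X P\<^esub> f = f" "f \<otimes>\<^bsub>T_monoid X P\<^esub> \<one>\<^bsub>T_monoid X P\<^esub> = f"
    using l_one[of f] r_one[of f] by (simp_all add: T_monoid_def)
qed

end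

theory Submission
  imports Defs
begin

text \<open>
  Elements of both sides permute the blocks, mapping each block onto a block.

  If \<open>f\<close> carries blocks onto blocks and its image meets every block, then every block is the image of
  a block, since two blocks that meet are equal (\<open>blocks_are_images\<close>). Hence \<open>f\<close> is onto, and
  finiteness of \<open>X\<close> makes it a bijection; its inverse then sends the block \<open>f ` A\<close> back to \<open>A\<close> and so
  respects the partition too.

  Conversely, let \<open>f\<close> and \<open>g\<close> be mutually inverse and both respect the partition. If \<open>f\<close> sends \<open>A\<close>
  into \<open>B\<close>, then \<open>g\<close> sends \<open>B\<close> into a block that meets \<open>A\<close>, that is, into \<open>A\<close> itself; applying
  \<open>f\<close> again shows that \<open>f\<close> maps \<open>A\<close> onto \<open>B\<close> (\<open>unit_in_Gamma\<close>). Being onto, \<open>f\<close> also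
  has an image that meets every block.
\<close>

lemma T_partD_closed: "f \<in> T_part X P \<Longrightarrow> x \<in> X \<Longrightarrow> f x \<in> X"
  by (auto simp: T_part_def full_transf_def)

lemma Gamma_subset_T: "Gamma_part X P \<subseteq> T_part X P"
  by (auto simp: Gamma_part_def T_part_def)

lemma S_part_iff:
  fixes f :: "'a \<Rightarrow> 'a"
  shows
  "f \<in> S_part X P \<longleftrightarrow>
     f \<in> T_part X P \<and> (\<exists>g\<in>T_part X P. (\<forall>x\<in>X. g (f x) = x) \<and> (\<forall>x\<in>X. f (g x) = x))"
proof -
  have "compose X k h = (\<lambda>x\<in>X. x) \<longleftrightarrow> (\<forall>x\<in>X. k (h x) = x)" for k h :: "'a \<Rightarrow> 'a"
    unfolding compose_def restrict_def fun_eq_iff by metis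
  then show ?thesis
    by (auto simp: S_part_def Units_def T_monoid_def full_transf_def)
qed

lemma partition_on_block_eq:
  assumes "partition_on X P" "A \<in> P" "B \<in> P" "x \<in> A" "x \<in> B"
  shows "A = B"
  using assms by (auto simp: partition_on_def disjoint_def)

text \<open>
  A block \<open>B\<close> contains some \<open>f x\<close>; the block of \<open>x\<close> is mapped onto a block containing \<open>f x\<close>,
  which can only be \<open>B\<close>.
\<close>

lemma blocks_are_images:
  assumes P: "partition_on X P"
    and \<Gamma>: "f \<in> Gamma_part X P" and \<Sigma>: "f \<in> Sigma_part X P" and B: "B \<in> P"
  shows "\<exists>A\<in>P. f ` A = B"
proof -
  obtain x where x: "x \<in> X" "f x \<in> B"
    using \<Sigma> B by (auto simp: Sigma_part_def)
  obtain A where A: "A \<in> P" "x \<in> A"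
    using x(1) P by (auto simp: partition_on_def)
  have "f ` A \<in> P"
    using \<Gamma> A(1) unfolding Gamma_part_def by blast
  then have "f ` A = B"
    using partition_on_block_eq[OF P _ B] A(2) x(2) by blast
  then show ?thesis using A(1) by blast
qed

lemma Gamma_Sigma_bij:
  assumes "finite X" and P: "partition_on X P"
    and \<Gamma>: "f \<in> Gamma_part X P" and \<Sigma>: "f \<in> Sigma_part X P"
  shows "bij_betw f X X"
proof -
  have "X \<subseteq> f ` X"
  proof
    fix y assume "y \<in> X"
    then obtain B where B: "B \<in> P" "y \<in> B"
      using P by (auto simp: partition_on_def)
    then obtain A where "A \<in> P" "f ` A = B"
      using blocks_are_images[OF P \<Gamma> \<Sigma>] by blast
    moreover have "A \<subseteq> X" using \<open>A \<in> P\<close> P by (auto simp: partition_on_def)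
    ultimately show "y \<in> f ` X" using B(2) by blast
  qed
  moreover have "f ` X \<subseteq> X"
    using T_partD_closed[OF subsetD[OF Gamma_subset_T \<Gamma>]] by blast
  ultimately have "f ` X = X" by blast
  with \<open>finite X\<close> show ?thesis
    by (simp add: bij_betw_def eq_card_imp_inj_on)
qed

text \<open>
  Bijectivity alone does not give an inverse inside \<open>T_part X P\<close>; that the inverse respects the
  partition is where \<open>blocks_are_images\<close> is used a second time.
\<close>

lemma Gamma_Sigma_subset_S:
  assumes "finite X" and P: "partition_on X P"
  shows "Gamma_part X P \<inter> Sigma_part X P \<subseteq> S_part X P"
proof
  fix f assume "f \<in> Gamma_part X P \<inter> Sigma_part X P"
  then have \<Gamma>: "f \<in> Gamma_part X P" and \<Sigma>: "f \<in> Sigma_part X P" by auto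
  have bij: "bij_betw f X X" by (rule Gamma_Sigma_bij[OF assms \<Gamma> \<Sigma>])
  define g where "g = restrict (inv_into X f) X"
  have gX: "g \<in> X \<rightarrow>\<^sub>E X"
    using bij_betw_apply[OF bij_betw_inv_into[OF bij]] by (auto simp: g_def)
  have gf: "g (f x) = x" if "x \<in> X" for x
    using that bij bij_betw_apply[OF bij] by (simp add: g_def bij_betw_inv_into_left)
  have fg: "f (g x) = x" if "x \<in> X" for x
    using that bij by (simp add: g_def bij_betw_inv_into_right)
  have "\<exists>A\<in>P. g ` B \<subseteq> A" if B: "B \<in> P" for B
  proof -
    obtain A where A: "A \<in> P" "f ` A = B"
      using blocks_are_images[OF P \<Gamma> \<Sigma> B] by blast
    have "A \<subseteq> X" using A(1) P by (auto simp: partition_on_def)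
    then have "g ` f ` A \<subseteq> A" using gf by auto
    then show ?thesis using A by blast
  qed
  then have "g \<in> T_part X P"
    using gX by (simp add: T_part_def full_transf_def)
  then show "f \<in> S_part X P"
    using \<Gamma> Gamma_subset_T gf fg unfolding S_part_iff by blast
qed

lemma unit_in_Gamma:
  assumes P: "partition_on X P" and f: "f \<in> S_part X P"
  shows "f \<in> Gamma_part X P"
proof -
  obtain g where fT: "f \<in> T_part X P" and gT: "g \<in> T_part X P"
    and gf: "\<And>x. x \<in> X \<Longrightarrow> g (f x) = x" and fg: "\<And>x. x \<in> X \<Longrightarrow> f (g x) = x"
    using f unfolding S_part_iff by blast
  have "\<exists>B\<in>P. f ` A = B" if A: "A \<in> P" for A
  proof -
    obtain B where B: "B \<in> P" "f ` A \<subseteq> B" using fT A by (auto simp: T_part_def)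
    obtain C where C: "C \<in> P" "g ` B \<subseteq> C" using gT B(1) by (auto simp: T_part_def)
    have sub: "A \<subseteq> X" "B \<subseteq> X" using A B(1) P by (auto simp: partition_on_def)
    obtain a where a: "a \<in> A" using A partition_onD3[OF P] by (metis ex_in_conv)
    have "g (f a) \<in> C" using a B(2) C(2) by blast
    then have "a \<in> C" using gf a sub(1) by auto
    have "C = A" using partition_on_block_eq[OF P C(1) A \<open>a \<in> C\<close> a] .
    have "B \<subseteq> f ` A"
    proof
      fix y assume "y \<in> B"
      then have "g y \<in> A" "f (g y) = y" using C(2) \<open>C = A\<close> fg sub(2) by auto
      then show "y \<in> f ` A" by (metis imageI)
    qed
    then show ?thesis using B by blast
  qed
  then show ?thesis using fT by (auto simp: Gamma_part_def T_part_def)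
qed

lemma unit_in_Sigma:
  assumes P: "partition_on X P" and f: "f \<in> S_part X P"
  shows "f \<in> Sigma_part X P"
proof -
  obtain g where fT: "f \<in> T_part X P" and gT: "g \<in> T_part X P"
    and fg: "\<And>x. x \<in> X \<Longrightarrow> f (g x) = x"
    using f unfolding S_part_iff by blast
  have "f ` X \<inter> A \<noteq> {}" if A: "A \<in> P" for A
  proof -
    obtain a where a: "a \<in> A" "a \<in> X"
      using A partition_onD1[OF P] partition_onD3[OF P] by (metis UnionI ex_in_conv)
    then have "f (g a) = a" "g a \<in> X" using fg T_partD_closed[OF gT] by auto
    then show ?thesis using a(1) by (metis IntI empty_iff imageI)
  qed
  then show ?thesis using fT by (simp add: Sigma_part_def)
qed

theorem proposition4p8:
  fixes X :: "'a set" and P :: "'a set set" and Xb :: "nat \<Rightarrow> 'a set" and m :: nat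
  assumes "finite X" and "card X \<ge> 3"
    and "partition_on X P"
    and "P = {Xb i | i. i \<in> {1..m}}" and "inj_on Xb {1..m}"
  shows "Gamma_part X P \<inter> Sigma_part X P = S_part X P"
  using Gamma_Sigma_subset_S[OF assms(1,3)] unit_in_Gamma[OF assms(3)] unit_in_Sigma[OF assms(3)]
  by blast

end
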